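(* For every $M>0$ there is an integer $h>0$ such that $\mathsf{pn}(T_{10}^h)\ge M$, where $T_{10}^h$ is the complete $10$-ary tree of height $h$.
   Context: $T_{10}^h$ denotes the complete rooted $10$-ary tree of height $h$ (every non-leaf vertex has exactly $10$ children, and all leaves have depth $h$). In a straight-line drawing $\Gamma$ of a graph $G$, the ply-disk $D_v$ of a vertex $v$ is the open disk centered at $v$ whose radius $r_v$ is half the length of the longest edge incident to $v$. For a point $q\in\mathbb{R}^2$ let $S_q=\{D_v : \|v-q\|<r_v\}$. The ply-number of $\Gamma$ is $\mathsf{pn}(\Gamma)=\max_{q\in\mathbb{R}^2}|S_q|$, and the ply-number of $G$ is $\mathsf{pn}(G)=\min_{\Gamma}\mathsf{pn}(\Gamma)$ over all straight-line drawings $\Gamma$ of $G$. *)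

theory Defs
  imports "HOL-Analysis.Analysis"
begin

text \<open>An undirected graph is a pair of a vertex set and a set of edges, each edge being the set
  of its two end vertices.\<close>

type_synonym 'v graph = "'v set \<times> 'v set set"

abbreviation verts :: "'v graph \<Rightarrow> 'v set" where "verts G \<equiv> fst G"
abbreviation edges :: "'v graph \<Rightarrow> 'v set set" where "edges G \<equiv> snd G"

definition finite_simple_graph :: "'v graph \<Rightarrow> bool" where
  "finite_simple_graph G \<longleftrightarrow>
     finite (verts G) \<and> (\<forall>e\<in>edges G. e \<subseteq> verts G \<and> card e = 2)"

text \<open>A straight-line drawing is determined by the positions of the vertices, which are pairwise
  distinct; an edge is drawn as the segment between its end vertices. Crossings are allowed.\<close>

definition straight_line_drawing :: "'v graph \<Rightarrow> ('v \<Rightarrow> real^2) \<Rightarrow> bool" where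
  "straight_line_drawing G \<Gamma> \<longleftrightarrow> inj_on \<Gamma> (verts G)"

text \<open>The inserted 0 only matters for isolated vertices, whose ply-disk is then empty.\<close>

definition ply_radius :: "'v graph \<Rightarrow> ('v \<Rightarrow> real^2) \<Rightarrow> 'v \<Rightarrow> real" where
  "ply_radius G \<Gamma> v = Max (insert 0 {dist (\<Gamma> v) (\<Gamma> w) | w. {v, w} \<in> edges G}) / 2"

definition ply_disk :: "'v graph \<Rightarrow> ('v \<Rightarrow> real^2) \<Rightarrow> 'v \<Rightarrow> (real^2) set" where
  "ply_disk G \<Gamma> v = ball (\<Gamma> v) (ply_radius G \<Gamma> v)"

definition ply_disks_at :: "'v graph \<Rightarrow> ('v \<Rightarrow> real^2) \<Rightarrow> real^2 \<Rightarrow> (real^2) set set" where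
  "ply_disks_at G \<Gamma> q =
     {ply_disk G \<Gamma> v | v. v \<in> verts G \<and> norm (\<Gamma> v - q) < ply_radius G \<Gamma> v}"

definition drawing_ply_number :: "'v graph \<Rightarrow> ('v \<Rightarrow> real^2) \<Rightarrow> nat" where
  "drawing_ply_number G \<Gamma> = Max {card (ply_disks_at G \<Gamma> q) | q. q \<in> UNIV}"

definition ply_number :: "'v graph \<Rightarrow> nat" where
  "ply_number G = Min {drawing_ply_number G \<Gamma> | \<Gamma>. straight_line_drawing G \<Gamma>}"

text \<open>The complete rooted \<open>d\<close>-ary tree of height \<open>h\<close>: a vertex is the list of child indices on
  the path leading to it from the root \<open>[]\<close>, so its depth is the length of the list.\<close>

definition complete_tree :: "nat \<Rightarrow> nat \<Rightarrow> nat list graph" where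
  "complete_tree d h =
     ({xs. set xs \<subseteq> {..<d} \<and> length xs \<le> h},
      {{xs, xs @ [i]} | xs i. set xs \<subseteq> {..<d} \<and> length xs < h \<and> i < d})"

lemma finite_simple_graph_complete_tree: "finite_simple_graph (complete_tree d h)"
  by (auto simp: finite_simple_graph_def complete_tree_def
      finite_lists_length_le card_insert_if)

text \<open>The extrema in the definitions of the ply-numbers are taken over finite nonempty sets.\<close>

lemma ply_disks_at_bound:
  assumes "finite_simple_graph G"
  shows "finite (ply_disks_at G \<Gamma> q)" "card (ply_disks_at G \<Gamma> q) \<le> card (verts G)"
proof -
  have sub: "ply_disks_at G \<Gamma> q \<subseteq> ply_disk G \<Gamma> ` verts G"
    by (auto simp: ply_disks_at_def)
  have fin: "finite (verts G)"
    using assms by (simp add: finite_simple_graph_def)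
  show "finite (ply_disks_at G \<Gamma> q)"
    using sub fin by (meson finite_imageI finite_subset)
  show "card (ply_disks_at G \<Gamma> q) \<le> card (verts G)"
    using sub fin by (meson card_image_le card_mono finite_imageI le_trans)
qed

lemma finite_ply_counts:
  assumes "finite_simple_graph G"
  shows "finite {card (ply_disks_at G \<Gamma> q) | q. q \<in> UNIV}"
    "{card (ply_disks_at G \<Gamma> q) | q. q \<in> UNIV} \<noteq> {}"
  using ply_disks_at_bound(2)[OF assms, of \<Gamma>]
  by (auto intro!: finite_subset[of _ "{..card (verts G)}"])

lemma finite_drawing_ply_numbers:
  assumes "finite_simple_graph G"
  shows "finite {drawing_ply_number G \<Gamma> | \<Gamma>. straight_line_drawing G \<Gamma>}"
    "{drawing_ply_number G \<Gamma> | \<Gamma>. straight_line_drawing G \<Gamma>} \<noteq> {}"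
proof -
  have "drawing_ply_number G \<Gamma> \<le> card (verts G)" for \<Gamma>
    unfolding drawing_ply_number_def
    using finite_ply_counts[OF assms, of \<Gamma>] ply_disks_at_bound(2)[OF assms, of \<Gamma>]
    by (subst Max_le_iff) auto
  then show "finite {drawing_ply_number G \<Gamma> | \<Gamma>. straight_line_drawing G \<Gamma>}"
    by (auto intro!: finite_subset[of _ "{..card (verts G)}"])
  have "finite (verts G)"
    using assms by (simp add: finite_simple_graph_def)
  then obtain f :: "'a \<Rightarrow> nat" where f: "inj_on f (verts G)"
    using finite_imp_inj_to_nat_seg by blast
  have "inj (\<lambda>n. (\<chi> i. real n) :: real^2)"
    by (auto simp: inj_def vec_eq_iff)
  then have "inj_on ((\<lambda>n. (\<chi> i. real n) :: real^2) \<circ> f) (verts G)"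
    using f by (meson comp_inj_on inj_on_subset subset_UNIV)
  then show "{drawing_ply_number G \<Gamma> | \<Gamma>. straight_line_drawing G \<Gamma>} \<noteq> {}"
    unfolding straight_line_drawing_def by blast
qed

end

theory Submission
  imports Defs "HOL-Real_Asymp.Real_Asymp"
begin

text \<open>Suppose that no point lies in more than \<open>M\<close> ply-disks. By induction on \<open>m\<close>, every sufficiently
  high tree contains a downward path whose end point lies in at least \<open>m\<close> disks of its vertices,
  which is absurd for \<open>m = M + 1\<close>.

  In the induction step, assume that \<open>m + 1\<close> is impossible and extend each path
  \<open>u_0, ..., u_k\<close> by a path of length at most \<open>H\<close> whose end is covered \<open>m\<close> times. The disk of no \<open>u_i\<close>
  contains this end, and an edge is at most twice the radius of its lower end, so the sum \<open>t_i\<close> of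
  the radii after \<open>u_i\<close> satisfies \<open>r(u_i) \<le> 2 t_i\<close>, whence \<open>t_(i-1) = r(u_i) + t_i \<le> 3 t_i\<close>. Thus
  each of the \<open>10^k\<close> vertices at level \<open>k\<close> has, within \<open>H\<close> further levels, a descendant of radius of
  order \<open>3^(-k) r(u_0)\<close>. The total area of these disks is of order \<open>(10/9)^k r(u_0)^2\<close>. If all radii
  in this part of the tree are at most \<open>2 r(u_0)\<close>, the disks lie within distance \<open>O(k r(u_0))\<close> of
  \<open>u_0\<close>, a contradiction for large \<open>k\<close>. Hence from every vertex one can double the radius within a
  bounded number \<open>K\<close> of steps. Choose a vertex \<open>x\<close> below which, for \<open>L = l + H\<close> levels,
  the radii are at most \<open>X = 4^L r(x)\<close>. From \<open>10^l\<close> descendants of \<open>x\<close>, repeated doubling leads to distinct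
  vertices of radius at least \<open>X\<close>, all of them at distance \<open>O((K + l) X)\<close> from \<open>x\<close> since the lengths of the
  way are dominated by a geometric series. This is impossible for large \<open>l\<close>.\<close>

section \<open>Bounded ply for points indexed by words\<close>

text \<open>The alphabet \<open>'a\<close> names the children. Only the values of \<open>p\<close> and \<open>r\<close> on words of length at
  most \<open>h\<close> matter.\<close>

definition low_ply ::
    "nat \<Rightarrow> nat \<Rightarrow> ('a::finite list \<Rightarrow> real^2) \<Rightarrow> ('a list \<Rightarrow> real) \<Rightarrow> bool" where
  "low_ply M h p r \<longleftrightarrow>
     (\<forall>x. length x \<le> h \<longrightarrow> 0 < r x) \<and>
     (\<forall>x i. length x < h \<longrightarrow>
        dist (p x) (p (x @ [i])) \<le> 2 * r x \<and> dist (p x) (p (x @ [i])) \<le> 2 * r (x @ [i])) \<and>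
     (\<forall>q. card {x. length x \<le> h \<and> dist (p x) q < r x} \<le> M)"

lemma low_ply_pos: "low_ply M h p r \<Longrightarrow> length x \<le> h \<Longrightarrow> 0 < r x"
  by (simp add: low_ply_def)

lemma low_ply_edge:
  assumes "low_ply M h p r" "length x < h"
  shows "dist (p x) (p (x @ [i])) \<le> 2 * r x" "dist (p x) (p (x @ [i])) \<le> 2 * r (x @ [i])"
  using assms by (auto simp: low_ply_def)

lemma finite_lists_bounded: "finite {x::'a::finite list. length x \<le> h \<and> P x}"
  by (rule finite_subset[OF _ finite_lists_length_le[of "UNIV::'a set" h]]) auto

lemma low_ply_card:
  assumes "low_ply M h p r" "\<And>x. x \<in> S \<Longrightarrow> length x \<le> h \<and> dist (p x) q < r x"
  shows "card S \<le> M"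
proof -
  have "card S \<le> card {x. length x \<le> h \<and> dist (p x) q < r x}"
    using assms(2) by (intro card_mono finite_lists_bounded) auto
  also have "\<dots> \<le> M"
    using assms(1) by (simp add: low_ply_def)
  finally show ?thesis .
qed

lemma low_ply_shift:
  assumes "low_ply M h p r" "length v + h' \<le> h"
  shows "low_ply M h' (\<lambda>x. p (v @ x)) (\<lambda>x. r (v @ x))"
proof -
  have "card {x. length x \<le> h' \<and> dist (p (v @ x)) q < r (v @ x)} \<le> M" for q
  proof -
    have "card {x. length x \<le> h' \<and> dist (p (v @ x)) q < r (v @ x)}
        = card ((@) v ` {x. length x \<le> h' \<and> dist (p (v @ x)) q < r (v @ x)})"
      by (rule card_image[symmetric]) (auto simp: inj_on_def)
    also have "\<dots> \<le> M"
      using assms(2) by (intro low_ply_card[OF assms(1)]) auto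
    finally show ?thesis .
  qed
  moreover have "dist (p (v @ x)) (p (v @ x @ [i])) \<le> 2 * r (v @ x) \<and>
      dist (p (v @ x)) (p (v @ x @ [i])) \<le> 2 * r (v @ x @ [i])" if "length x < h'" for x i
    using low_ply_edge[OF assms(1), of "v @ x" i] that assms(2) by simp
  ultimately show ?thesis
    using assms low_ply_pos[OF assms(1)] by (auto simp: low_ply_def)
qed

text \<open>Each edge is charged to its upper end in the first bound, which omits the radius at
  \<open>x @ e\<close>, and to its lower end in the second, which omits \<open>r x\<close>; the
  second thus allows comparing \<open>r x\<close> with later radii.\<close>

lemma low_ply_path:
  assumes lp: "low_ply M h p r" and len: "length x + length e \<le> h"
  shows "dist (p x) (p (x @ e)) \<le> 2 * (\<Sum>j<length e. r (x @ take j e))"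
    and "dist (p x) (p (x @ e)) \<le> 2 * (\<Sum>j\<in>{0<..length e}. r (x @ take j e))"
  using len
proof (induction e rule: rev_induct)
  case (snoc i e)
  have tri: "dist (p x) (p (x @ e @ [i])) \<le>
      dist (p x) (p (x @ e)) + dist (p (x @ e)) (p (x @ e @ [i]))"
    by (rule dist_triangle)
  have ivl: "{0<..Suc n} = insert (Suc n) {0<..n}" for n :: nat
    by auto
  {
    case 1
    have "(\<Sum>j<length e. r (x @ take j (e @ [i]))) = (\<Sum>j<length e. r (x @ take j e))"
      by (intro sum.cong) auto
    with 1 snoc.IH(1) tri low_ply_edge(1)[OF lp, of "x @ e" i] show ?case
      by simp
  next
    case 2
    have "(\<Sum>j\<in>{0<..length e}. r (x @ take j (e @ [i]))) = (\<Sum>j\<in>{0<..length e}. r (x @ take j e))"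
      by (intro sum.cong) auto
    with 2 snoc.IH(2) tri low_ply_edge(2)[OF lp, of "x @ e" i] show ?case
      by (simp add: ivl)
  }
qed auto

lemma low_ply_path_bound:
  assumes lp: "low_ply M h p r" and len: "length x + length e \<le> h"
    and R: "\<And>j. j < length e \<Longrightarrow> r (x @ take j e) \<le> R" and K: "length e \<le> K" "0 \<le> R"
  shows "dist (p x) (p (x @ e)) \<le> 2 * real K * R"
proof -
  have "dist (p x) (p (x @ e)) \<le> 2 * (\<Sum>j<length e. r (x @ take j e))"
    by (rule low_ply_path(1)[OF lp len])
  also have "(\<Sum>j<length e. r (x @ take j e)) \<le> real (length e) * R"
    using sum_bounded_above[of "{..<length e}" "\<lambda>j. r (x @ take j e)" R] R by simp
  also have "real (length e) * R \<le> real K * R"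
    using K by (intro mult_right_mono) auto
  finally show ?thesis by simp
qed

section \<open>Area packing\<close>

text \<open>The balls of radius \<open>\<rho>\<close> around the points \<open>p x\<close> lie in
  the ball of radius \<open>R + \<rho>\<close> around \<open>q\<close>, and no point is in more than
  \<open>M\<close> of them. Integrating indicator functions compares the areas.\<close>

lemma low_ply_packing:
  assumes lp: "low_ply M h p r" and fin: "finite S" and "0 < \<rho>" "0 \<le> R"
    and S: "\<And>x. x \<in> S \<Longrightarrow> length x \<le> h \<and> \<rho> \<le> r x \<and> dist (p x) q \<le> R"
  shows "real (card S) * \<rho>\<^sup>2 \<le> real M * (R + \<rho>)\<^sup>2"
proof -
  have vol: "measure lborel (ball c s) = unit_ball_vol 2 * s\<^sup>2" if "0 \<le> s" for c :: "real^2" and s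
    using content_ball[OF that, of c] by (simp add: measure_completion)
  have int: "integrable lborel (indicat_real (ball c s))" for c :: "real^2" and s
    using emeasure_lborel_ball_finite[of c s] by (intro integrable_real_indicator) auto
  have "(\<Sum>x\<in>S. indicat_real (ball (p x) \<rho>) y) \<le> real M * indicat_real (ball q (R + \<rho>)) y" for y
  proof (cases "y \<in> ball q (R + \<rho>)")
    case True
    have "(\<Sum>x\<in>S. indicat_real (ball (p x) \<rho>) y) = real (card {x \<in> S. y \<in> ball (p x) \<rho>})"
      using fin by (simp add: indicator_def sum.If_cases Int_def)
    also have "card {x \<in> S. y \<in> ball (p x) \<rho>} \<le> M"
      using S by (intro low_ply_card[OF lp, of _ y]) force
    finally show ?thesis
      using True by simp
  next
    case False
    have "y \<notin> ball (p x) \<rho>" if "x \<in> S" for x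
      using S[OF that] False dist_triangle[of q y "p x"] by (auto simp: dist_commute)
    then show ?thesis
      using False by (simp add: indicator_def)
  qed
  then have "(\<integral>y. (\<Sum>x\<in>S. indicat_real (ball (p x) \<rho>) y) \<partial>lborel)
      \<le> (\<integral>y. real M * indicat_real (ball q (R + \<rho>)) y \<partial>lborel)"
    using int by (intro integral_mono Bochner_Integration.integrable_sum
        Bochner_Integration.integrable_mult_right) auto
  then have "real (card S) * (unit_ball_vol 2 * \<rho>\<^sup>2) \<le> real M * (unit_ball_vol 2 * (R + \<rho>)\<^sup>2)"
    using int assms(3,4) by (simp add: Bochner_Integration.integral_sum vol)
  then have "unit_ball_vol 2 * (real (card S) * \<rho>\<^sup>2) \<le> unit_ball_vol 2 * (real M * (R + \<rho>)\<^sup>2)"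
    by (simp add: algebra_simps)
  then show ?thesis
    by (simp add: unit_ball_vol_pos)
qed

text \<open>Words that differ in the \<open>k\<close> letters after \<open>x\<close> are distinct,
  so one extension per choice of these letters yields at least \<open>10 ^ k\<close> disks to
  pack.\<close>

lemma low_ply_level_packing:
  fixes p :: "'a::finite list \<Rightarrow> real^2"
  assumes lp: "low_ply M h p r" and ten: "10 \<le> CARD('a)" and "0 < \<rho>" "0 \<le> R"
    and S: "\<And>f. length f = k \<Longrightarrow> \<exists>e. length (x @ f @ e) \<le> h \<and> \<rho> \<le> r (x @ f @ e) \<and>
              dist (p x) (p (x @ f @ e)) \<le> R"
  shows "10 ^ k * \<rho>\<^sup>2 \<le> real M * (R + \<rho>)\<^sup>2"
proof -
  obtain g where g: "\<And>f. length f = k \<Longrightarrow> length (x @ f @ g f) \<le> h \<and> \<rho> \<le> r (x @ f @ g f) \<and>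
              dist (p x) (p (x @ f @ g f)) \<le> R"
    using S by metis
  let ?F = "{f::'a list. length f = k}"
  have F: "finite ?F" "card ?F = CARD('a) ^ k"
    using card_lists_length_eq[of "UNIV::'a set" k] finite_lists_length_eq[of "UNIV::'a set" k]
    by auto
  have "inj_on (\<lambda>f. x @ f @ g f) ?F"
    by (auto simp: inj_on_def)
  then have "card ((\<lambda>f. x @ f @ g f) ` ?F) = CARD('a) ^ k"
    by (simp add: card_image F)
  moreover have "real (card ((\<lambda>f. x @ f @ g f) ` ?F)) * \<rho>\<^sup>2 \<le> real M * (R + \<rho>)\<^sup>2"
    using F g assms(3,4) by (intro low_ply_packing[OF lp, of _ _ _ "p x"]) (auto simp: dist_commute)
  moreover have "(10::real) ^ k \<le> real (CARD('a)) ^ k"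
    using ten by (intro power_mono) auto
  then have "10 ^ k * \<rho>\<^sup>2 \<le> real (CARD('a)) ^ k * \<rho>\<^sup>2"
    by (rule mult_right_mono) simp
  ultimately show ?thesis
    by simp
qed

section \<open>Vertices below which radii grow at a bounded rate\<close>

text \<open>Adding \<open>b n\<close> to the partial sum before it multiplies that sum by at most
  4.\<close>

lemma no_superjump_bound:
  fixes b :: "nat \<Rightarrow> real"
  assumes "\<And>n. 0 < n \<Longrightarrow> n \<le> N \<Longrightarrow> b n \<le> 3 * (\<Sum>j<n. b j)" "n \<le> N" "\<And>n. n \<le> N \<Longrightarrow> 0 \<le> b n"
  shows "b n \<le> 4 ^ n * b 0"
proof -
  have "(\<Sum>j<Suc n. b j) \<le> 4 ^ n * b 0"
    using assms(2)
  proof (induction n)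
    case (Suc n)
    then show ?case
      using assms(1)[of "Suc n"] by simp
  qed simp
  moreover have "0 \<le> (\<Sum>j<n. b j)"
    using assms(2,3) by (intro sum_nonneg) auto
  ultimately show ?thesis
    by simp
qed

lemma sum_append_prefixes:
  "(\<Sum>j<length (x @ e). r (take j (x @ e)))
     = (\<Sum>j<length x. r (take j x)) + (\<Sum>j<length e. r (x @ take j e))"
  for r :: "'a list \<Rightarrow> real"
proof (induction e rule: rev_induct)
  case (snoc i e)
  have "(\<Sum>j<length (x @ e). r (take j (x @ e @ [i]))) = (\<Sum>j<length (x @ e). r (take j (x @ e)))"
    by (intro sum.cong) (auto simp: take_Cons split: nat.split)
  moreover have "(\<Sum>j<length e. r (x @ take j (e @ [i]))) = (\<Sum>j<length e. r (x @ take j e))"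
    by (intro sum.cong) auto
  ultimately show ?case
    using snoc by simp
qed simp

text \<open>If every vertex had a descendant whose radius exceeds three times the sum of the radii on the
  way to it, then iterating from the root would produce \<open>M + 1\<close> disks containing the root.\<close>

lemma no_superjump_vertex:
  fixes p :: "'a::finite list \<Rightarrow> real^2"
  assumes lp: "low_ply M h p r" and h: "M * L \<le> h"
  obtains x where "length x \<le> M * L"
    "\<And>e. 0 < length e \<Longrightarrow> length e \<le> L \<Longrightarrow> r (x @ e) \<le> 3 * (\<Sum>j<length e. r (x @ take j e))"
proof (rule ccontr)
  assume "\<not> thesis"
  with that have jump: "\<exists>e. 0 < length e \<and> length e \<le> L \<and> 3 * (\<Sum>j<length e. r (x @ take j e)) < r (x @ e)"
    if "length x \<le> M * L" for x
    using that by (meson not_le_imp_less)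
  let ?C = "\<lambda>x. {j. j \<le> length x \<and> dist (p (take j x)) (p []) < r (take j x)}"
  have "\<exists>x. length x \<le> n * L \<and> 2 * (\<Sum>j<length x. r (take j x)) < r x \<and> n < card (?C x)"
    if "n \<le> M" for n
    using that
  proof (induction n)
    case 0
    have "0 < r []"
      using low_ply_pos[OF lp] by simp
    then have "?C [] = {0}"
      by auto
    with \<open>0 < r []\<close> show ?case
      by (intro exI[of _ "[]"]) simp
  next
    case (Suc n)
    then obtain x where x: "length x \<le> n * L" "2 * (\<Sum>j<length x. r (take j x)) < r x" "n < card (?C x)"
      by auto
    have nL: "n * L + L \<le> M * L"
      using Suc.prems by (metis add.commute mult_Suc mult_le_mono1)
    with x(1) jump[of x] obtain e where e: "0 < length e" "length e \<le> L"
      "3 * (\<Sum>j<length e. r (x @ take j e)) < r (x @ e)"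
      by auto
    have len: "length (x @ e) \<le> h"
      using x(1) e(2) nL h by simp
    \<comment> \<open>As \<open>r x\<close> is a term of the new sum \<open>s\<close>, the sum
      before \<open>x\<close> is below \<open>s / 2\<close>, and twice the whole sum is below
      \<open>3 * s\<close>.\<close>
    have "r (x @ take 0 e) \<le> (\<Sum>j<length e. r (x @ take j e))"
      using e(1) len low_ply_pos[OF lp]
      by (intro member_le_sum) (auto intro!: less_imp_le)
    with x(2) e(3) have sum: "2 * (\<Sum>j<length (x @ e). r (take j (x @ e))) < r (x @ e)"
      unfolding sum_append_prefixes by simp
    have "dist (p (x @ e)) (p []) < r (x @ e)"
      using low_ply_path(1)[OF lp, of "[]" "x @ e"] len sum by (simp add: dist_commute)
    then have "insert (length (x @ e)) (?C x) \<subseteq> ?C (x @ e)"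
      by auto
    then have "card (insert (length (x @ e)) (?C x)) \<le> card (?C (x @ e))"
      by (intro card_mono) auto
    moreover have "length (x @ e) \<notin> ?C x"
      using e(1) by simp
    ultimately have "Suc n < card (?C (x @ e))"
      using x(3) by simp
    with sum x(1) e(2) show ?case
      by (intro exI[of _ "x @ e"]) auto
  qed
  then obtain x where x: "length x \<le> M * L" "M < card (?C x)"
    by blast
  have "card ((\<lambda>j. take j x) ` ?C x) = card (?C x)"
    by (intro card_image) (auto simp: inj_on_def dest: arg_cong[where f = length])
  moreover have "card ((\<lambda>j. take j x) ` ?C x) \<le> M"
    using x(1) h by (intro low_ply_card[OF lp, of _ "p []"]) auto
  ultimately show False
    using x(2) by simp
qed

section \<open>Climbing by repeated doubling\<close>

text \<open>The term \<open>- 4 K r(w)\<close> absorbs the length of the next doubling step in the induction.\<close>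

lemma low_ply_climb:
  fixes p :: "'a::finite list \<Rightarrow> real^2"
  assumes lp: "low_ply M h p r"
    and dbl: "\<And>v. length v + K \<le> h \<Longrightarrow> \<exists>e. length e \<le> K \<and> 2 * r v < r (v @ e)"
    and "length w + K * n \<le> h" "r w < X" "X \<le> 2 ^ n * r w"
  shows "\<exists>e. length e \<le> K * n \<and> X \<le> r (w @ e) \<and>
    dist (p w) (p (w @ e)) \<le> 8 * real K * X - 4 * real K * r w"
  using assms(3-5)
proof (induction n arbitrary: w)
  case (Suc n)
  have w0: "0 < r w"
    using low_ply_pos[OF lp] Suc.prems(1) by simp
  define P where "P e \<longleftrightarrow> length e \<le> K \<and> 2 * r w < r (w @ e)" for e
  have "\<exists>e. P e"
    using dbl[of w] Suc.prems(1) by (simp add: P_def)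
  \<comment> \<open>A shortest doubling path keeps all radii before its end at most
    \<open>2 * r w\<close>, which bounds its length in the plane.\<close>
  then obtain e where e: "P e" and min: "\<And>e'. P e' \<Longrightarrow> length e \<le> length e'"
    using ex_has_least_nat[of P _ length] by blast
  have len: "length w + length e \<le> h"
    using e Suc.prems(1) by (simp add: P_def)
  have "r (w @ take j e) \<le> 2 * r w" if "j < length e" for j
    using min[of "take j e"] e that by (force simp: P_def)
  then have d: "dist (p w) (p (w @ e)) \<le> 2 * real K * (2 * r w)"
    using e w0 by (intro low_ply_path_bound[OF lp len]) (auto simp: P_def)
  show ?case
  proof (cases "r (w @ e) < X")
    case True
    have "\<exists>e'. length e' \<le> K * n \<and> X \<le> r ((w @ e) @ e') \<and>
      dist (p (w @ e)) (p ((w @ e) @ e')) \<le> 8 * real K * X - 4 * real K * r (w @ e)"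
    proof (rule Suc.IH[OF _ True])
      show "length (w @ e) + K * n \<le> h"
        using Suc.prems(1) e by (simp add: P_def)
      have "2 ^ n * (2 * r w) \<le> 2 ^ n * r (w @ e)"
        using e by (intro mult_left_mono) (auto simp: P_def)
      moreover have "X \<le> 2 ^ n * (2 * r w)"
        using Suc.prems(3) by (simp add: mult.assoc mult.left_commute)
      ultimately show "X \<le> 2 ^ n * r (w @ e)"
        by linarith
    qed
    then obtain e' where e': "length e' \<le> K * n" "X \<le> r ((w @ e) @ e')"
      "dist (p (w @ e)) (p ((w @ e) @ e')) \<le> 8 * real K * X - 4 * real K * r (w @ e)"
      by blast
    \<comment> \<open>Of the at least \<open>8 * K * r w\<close> subtracted at \<open>w @ e\<close>,
      half pays for this step and half remains as the term for \<open>w\<close>.\<close>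
    have "4 * real K * (2 * r w) \<le> 4 * real K * r (w @ e)"
      using e by (intro mult_left_mono) (auto simp: P_def)
    with d e'(3) dist_triangle[of "p w" "p ((w @ e) @ e')" "p (w @ e)"]
    have "dist (p w) (p (w @ e @ e')) \<le> 8 * real K * X - 4 * real K * r w"
      by simp
    with e' e show ?thesis
      by (intro exI[of _ "e @ e'"]) (auto simp: P_def)
  next
    case False
    have "8 * real K * r w \<le> 8 * real K * X"
      using Suc.prems(2) by (intro mult_left_mono) auto
    with False d e show ?thesis
      by (intro exI[of _ e]) (auto simp: P_def)
  qed
qed simp

text \<open>Used with \<open>D = 9\<close>, where radii may shrink like \<open>3 ^ (-k)\<close> and
  areas like \<open>9 ^ (-k)\<close>, and with \<open>D = 1\<close>, where all packed radii are at
  least a fixed \<open>X\<close>.\<close>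

lemma exists_power_gt:
  fixes C D :: real
  assumes "0 < D" "D < 10"
  shows "\<exists>k. C * (4 * real (k + H) + c)\<^sup>2 * D ^ k < 10 ^ k"
proof -
  have "(\<lambda>k. C * (4 * (real k + real H) + c)\<^sup>2 * (D / 10) ^ k) \<longlonglongrightarrow> 0"
    using assms by real_asymp
  then have "eventually (\<lambda>k. C * (4 * (real k + real H) + c)\<^sup>2 * (D / 10) ^ k < 1) sequentially"
    by (rule order_tendstoD) simp
  then obtain k where "C * (4 * (real k + real H) + c)\<^sup>2 * (D / 10) ^ k < 1"
    by (auto simp: eventually_sequentially)
  then show ?thesis
    by (intro exI[of _ k]) (simp add: power_divide field_simps)
qed

section \<open>Slow decay of radii and why it fails in high trees\<close>

text \<open>The factor \<open>3 ^ length f\<close> is the growth of tail sums along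
  \<open>f\<close>; \<open>real H\<close> arises from bounding a sum of at most \<open>H\<close>
  radii by its largest term.\<close>

definition slow_decay :: "nat \<Rightarrow> nat \<Rightarrow> ('a list \<Rightarrow> real) \<Rightarrow> bool" where
  "slow_decay H h r \<longleftrightarrow> (\<forall>x f. length x + length f + H \<le> h \<longrightarrow>
     (\<exists>e. length e \<le> H \<and> r x \<le> 2 * 3 ^ length f * real H * r (x @ f @ e)))"

lemma slow_decayE:
  assumes "slow_decay H h r" "length x + length f + H \<le> h"
  obtains e where "length e \<le> H" "r x \<le> 2 * 3 ^ length f * real H * r (x @ f @ e)"
  using assms by (auto simp: slow_decay_def)

lemma slow_decay_doubling:
  fixes p :: "'a::finite list \<Rightarrow> real^2"
  assumes lp: "low_ply M h p r" and sd: "slow_decay H h r" and ten: "10 \<le> CARD('a)"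
    and k: "(real M * (2 * real H)\<^sup>2) * (4 * real (k + H) + 1)\<^sup>2 * 9 ^ k < 10 ^ k"
    and len: "length v + (k + H) \<le> h"
  shows "\<exists>e. length e \<le> k + H \<and> 2 * r v < r (v @ e)"
proof (rule ccontr)
  assume "\<not> ?thesis"
  then have small: "r (v @ e) \<le> 2 * r v" if "length e \<le> k + H" for e
    using that by force
  have v0: "0 < r v"
    using low_ply_pos[OF lp] len by simp
  \<comment> \<open>For \<open>H = 0\<close>, slow decay with empty \<open>f\<close> would give
    \<open>r v \<le> 0\<close>. Hence \<open>c\<close> below is at least 1.\<close>
  have "H \<noteq> 0"
  proof
    assume "H = 0"
    with slow_decayE[OF sd, of v "[]"] len v0 show False
      by simp
  qed
  define c where "c = 2 * 3 ^ k * real H"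
  have "1 * 1 \<le> 3 ^ k * real H"
    using \<open>H \<noteq> 0\<close> by (intro mult_mono) auto
  then have c: "1 \<le> c"
    by (simp add: c_def)
  let ?K = "real (k + H)"
  have "10 ^ k * (r v / c)\<^sup>2 \<le> real M * (4 * ?K * r v + r v / c)\<^sup>2"
  proof (rule low_ply_level_packing[OF lp ten])
    fix f :: "'a list" assume f: "length f = k"
    obtain e where e: "length e \<le> H" "r v \<le> c * r (v @ f @ e)"
      using slow_decayE[OF sd, of v f] len f by (auto simp: c_def)
    have "dist (p v) (p (v @ (f @ e))) \<le> 2 * ?K * (2 * r v)"
      using e f len v0 small by (intro low_ply_path_bound[OF lp]) auto
    then have "dist (p v) (p (v @ f @ e)) \<le> 4 * ?K * r v"
      by (simp only: mult.assoc mult.left_commute[of ?K 2 "r v"])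
    with e f len c show "\<exists>e. length (v @ f @ e) \<le> h \<and> r v / c \<le> r (v @ f @ e) \<and>
        dist (p v) (p (v @ f @ e)) \<le> 4 * ?K * r v"
      by (intro exI[of _ e]) (simp add: divide_le_eq mult.commute)
  qed (use c v0 in auto)
  also have "\<dots> \<le> real M * ((4 * ?K + 1) * r v)\<^sup>2"
    using c v0 by (intro mult_left_mono power_mono) (auto simp: algebra_simps divide_le_eq)
  finally have "10 ^ k * (r v)\<^sup>2 \<le> (real M * (4 * ?K + 1)\<^sup>2 * c\<^sup>2) * (r v)\<^sup>2"
    using c by (simp add: power_divide power_mult_distrib divide_le_eq mult_ac)
  then have "10 ^ k \<le> real M * (4 * ?K + 1)\<^sup>2 * c\<^sup>2"
    using v0 by simp
  moreover have "c\<^sup>2 = (2 * real H)\<^sup>2 * 9 ^ k"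
    by (simp add: c_def power2_eq_square mult_ac flip: power_mult_distrib)
  ultimately show False
    using k by (simp add: mult_ac)
qed

text \<open>The order of choices matters: \<open>k\<close> fixes the doubling distance
  \<open>K\<close>, and \<open>l\<close> is then large against \<open>K\<close>. Measured in units
  of \<open>X\<close>, the distances from \<open>x\<close> to the packed vertices grow only linearly
  in \<open>l\<close>.\<close>

lemma slow_decay_height_bound:
  assumes ten: "10 \<le> CARD('a::finite)"
  shows "\<exists>h. \<forall>(p::'a list \<Rightarrow> real^2) r. low_ply M h p r \<longrightarrow> \<not> slow_decay H h r"
proof -
  obtain k where k: "(real M * (2 * real H)\<^sup>2) * (4 * real (k + H) + 1)\<^sup>2 * 9 ^ k < 10 ^ k"
    using exists_power_gt by force
  define K where "K = k + H"
  obtain l where l: "real M * (4 * real (l + H) + (8 * real K + 1))\<^sup>2 * 1 ^ l < 10 ^ l"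
    using exists_power_gt[of 1] by force
  define L where "L = l + H"
  \<comment> \<open>\<open>n\<close> bounds \<open>X / r w\<close> for each \<open>w\<close> below,
    and \<open>n \<le> 2 ^ n\<close>, so \<open>n\<close> doublings suffice to reach
    \<open>X\<close>.\<close>
  define n where "n = 4 ^ L * (2 * 3 ^ l * H)"
  define h where "h = M * L + L + K * n + K"
  have False if lp: "low_ply M h p r" and sd: "slow_decay H h r"
    for p :: "'a list \<Rightarrow> real^2" and r
  proof -
    have dbl: "\<exists>e. length e \<le> K \<and> 2 * r v < r (v @ e)" if "length v + K \<le> h" for v
      using slow_decay_doubling[OF lp sd ten k] that by (simp add: K_def)
    obtain x where x: "length x \<le> M * L" and
      jump: "\<And>e. 0 < length e \<Longrightarrow> length e \<le> L \<Longrightarrow> r (x @ e) \<le> 3 * (\<Sum>j<length e. r (x @ take j e))"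
      using no_superjump_vertex[OF lp, of L] by (auto simp: h_def)
    have x0: "0 < r x"
      using low_ply_pos[OF lp] x by (simp add: h_def)
    define X where "X = 4 ^ L * r x"
    have X0: "0 < X"
      using x0 by (simp add: X_def)
    have top: "r (x @ e) \<le> X" if e: "length e \<le> L" for e
    proof -
      have "r (x @ take (length e) e) \<le> 4 ^ length e * r (x @ take 0 e)"
      proof (rule no_superjump_bound)
        fix m assume "0 < m" "m \<le> length e"
        with jump[of "take m e"] e
        have "r (x @ take m e) \<le> 3 * (\<Sum>j<m. r (x @ take j (take m e)))"
          by simp
        also have "(\<Sum>j<m. r (x @ take j (take m e))) = (\<Sum>j<m. r (x @ take j e))"
          by (intro sum.cong) (auto simp: min_def)
        finally show "r (x @ take m e) \<le> 3 * (\<Sum>j<m. r (x @ take j e))" .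
      next
        fix m assume "m \<le> length e"
        with x e low_ply_pos[OF lp, of "x @ take m e"] show "0 \<le> r (x @ take m e)"
          by (simp add: h_def)
      qed simp
      also have "\<dots> \<le> 4 ^ L * r x"
        using e x0 by (auto intro!: power_increasing)
      finally show ?thesis
        by (simp add: X_def)
    qed
    have "10 ^ l * X\<^sup>2 \<le> real M * ((8 * real K + 2 * real L) * X + X)\<^sup>2"
    proof (rule low_ply_level_packing[OF lp ten])
      fix f :: "'a list" assume f: "length f = l"
      obtain e where e: "length e \<le> H" "r x \<le> 2 * 3 ^ l * real H * r (x @ f @ e)"
        using slow_decayE[OF sd, of x f] x f by (auto simp: h_def L_def)
      define w where "w = x @ f @ e"
      have w: "length w \<le> M * L + L"
        using e f x by (simp add: w_def L_def)
      have w0: "0 < r w"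
        using low_ply_pos[OF lp] w by (simp add: h_def)
      have dw: "dist (p x) (p w) \<le> 2 * real L * X"
        unfolding w_def using e f x X0 top
        by (intro low_ply_path_bound[OF lp]) (auto simp: h_def L_def)
      have "\<exists>e'. length e' \<le> K * n \<and> X \<le> r (w @ e') \<and> dist (p w) (p (w @ e')) \<le> 8 * real K * X"
      proof (cases "r w < X")
        case True
        have "X \<le> 4 ^ L * (2 * 3 ^ l * real H * r w)"
          unfolding X_def using e by (intro mult_left_mono) (auto simp: w_def)
        also have "\<dots> = real n * r w"
          by (simp add: n_def)
        also have "\<dots> \<le> 2 ^ n * r w"
          using w0 by (intro mult_right_mono) auto
        finally have "\<exists>e'. length e' \<le> K * n \<and> X \<le> r (w @ e') \<and>
            dist (p w) (p (w @ e')) \<le> 8 * real K * X - 4 * real K * r w"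
          using w True by (intro low_ply_climb[OF lp dbl]) (auto simp: h_def)
        moreover have "0 \<le> 4 * real K * r w"
          using w0 by simp
        ultimately show ?thesis
          by (smt (verit))
      next
        case False
        with X0 show ?thesis
          by (intro exI[of _ "[]"]) simp
      qed
      then obtain e' where e': "length e' \<le> K * n" "X \<le> r (w @ e')"
        "dist (p w) (p (w @ e')) \<le> 8 * real K * X"
        by blast
      have "dist (p x) (p (w @ e')) \<le> (8 * real K + 2 * real L) * X"
        using dist_triangle[of "p x" "p (w @ e')" "p w"] dw e'(3) by (simp add: algebra_simps)
      with e' w show "\<exists>e. length (x @ f @ e) \<le> h \<and> X \<le> r (x @ f @ e) \<and>
          dist (p x) (p (x @ f @ e)) \<le> (8 * real K + 2 * real L) * X"
        by (intro exI[of _ "e @ e'"]) (auto simp: w_def h_def)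
    qed (use X0 in auto)
    also have "\<dots> = (real M * (8 * real K + 2 * real L + 1)\<^sup>2) * X\<^sup>2"
      by (simp add: power_mult_distrib[symmetric] algebra_simps)
    finally have "10 ^ l \<le> real M * (8 * real K + 2 * real L + 1)\<^sup>2"
      using X0 by simp
    also have "\<dots> \<le> real M * (4 * real (l + H) + (8 * real K + 1))\<^sup>2"
      by (intro mult_left_mono power_mono) (auto simp: L_def)
    finally show False
      using l by simp
  qed
  then show ?thesis
    by blast
qed

section \<open>Paths whose end is covered many times\<close>

text \<open>Each shortening of the tail by one term costs a factor 3, since the dropped term is at
  most twice the rest.\<close>

lemma tail_sum_bound:
  fixes a :: "nat \<Rightarrow> real"
  assumes "\<And>i. i \<le> k \<Longrightarrow> a i \<le> 2 * (\<Sum>j\<in>{i<..n}. a j)" "k \<le> n"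
  shows "(\<Sum>j\<in>{0<..n}. a j) \<le> 3 ^ k * (\<Sum>j\<in>{k<..n}. a j)"
  using assms
proof (induction k)
  case (Suc k)
  have "{k<..n} = insert (Suc k) {Suc k<..n}"
    using Suc.prems by auto
  then have "(\<Sum>j\<in>{k<..n}. a j) = a (Suc k) + (\<Sum>j\<in>{Suc k<..n}. a j)"
    by simp
  also have "\<dots> \<le> 3 * (\<Sum>j\<in>{Suc k<..n}. a j)"
    using Suc.prems(1)[of "Suc k"] by simp
  finally have "3 ^ k * (\<Sum>j\<in>{k<..n}. a j) \<le> 3 ^ k * (3 * (\<Sum>j\<in>{Suc k<..n}. a j))"
    by (rule mult_left_mono) simp
  moreover have "(\<Sum>j\<in>{0<..n}. a j) \<le> 3 ^ k * (\<Sum>j\<in>{k<..n}. a j)"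
    using Suc by simp
  ultimately have "(\<Sum>j\<in>{0<..n}. a j) \<le> 3 ^ k * (3 * (\<Sum>j\<in>{Suc k<..n}. a j))"
    by linarith
  then show ?case
    by simp
qed simp

text \<open>Prefixes are recorded by length. Leaving out length 0 keeps the start of an inner path
  free to serve as an additional covering vertex.\<close>

abbreviation covers :: "('a list \<Rightarrow> real^2) \<Rightarrow> ('a list \<Rightarrow> real) \<Rightarrow> 'a list \<Rightarrow> nat set" where
  "covers p r e \<equiv> {j. 0 < j \<and> j \<le> length e \<and> dist (p (take j e)) (p e) < r (take j e)}"

text \<open>An inner path with \<open>m\<close> covers is attached at \<open>v0 # x @ f\<close>. No
  vertex from \<open>v0 # x\<close> down to its start may cover the end as well, which bounds their
  radii by twice the tail sums. The letter \<open>v0\<close> makes \<open>v0 # x\<close> a counted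
  prefix even for empty \<open>x\<close>.\<close>

lemma covered_path_or_slow_decay:
  fixes p :: "'a::finite list \<Rightarrow> real^2"
  assumes IH: "\<And>(p::'a list \<Rightarrow> real^2) r. low_ply M H p r \<Longrightarrow> \<exists>e. length e \<le> H \<and> m \<le> card (covers p r e)"
    and lp: "low_ply M (Suc h) p r"
    and no: "\<And>e. length e \<le> Suc h \<Longrightarrow> card (covers p r e) \<le> m"
  shows "slow_decay H h (\<lambda>x. r (v0 # x))"
  unfolding slow_decay_def
proof (intro allI impI, rule ccontr)
  fix x f :: "'a list"
  assume len: "length x + length f + H \<le> h"
    and "\<not> (\<exists>e. length e \<le> H \<and> r (v0 # x) \<le> 2 * 3 ^ length f * real H * r (v0 # x @ f @ e))"
  then have fast: "2 * 3 ^ length f * real H * r (v0 # x @ f @ e) < r (v0 # x)" if "length e \<le> H" for e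
    using that by force
  define y where "y = v0 # x"
  define w where "w = y @ f"
  have "low_ply M H (\<lambda>x. p (w @ x)) (\<lambda>x. r (w @ x))"
    using len by (intro low_ply_shift[OF lp]) (simp add: w_def y_def)
  from IH[OF this] obtain e where e: "length e \<le> H"
    "m \<le> card (covers (\<lambda>x. p (w @ x)) (\<lambda>x. r (w @ x)) e)"
    by blast
  define g where "g = f @ e"
  define a where "a j = r (y @ take j g)" for j
  let ?k = "length f" and ?n = "length g"
  have lenE: "length (w @ e) \<le> Suc h"
    using e(1) len by (simp add: w_def y_def)
  have pos: "0 < a j" for j
    unfolding a_def using lenE by (intro low_ply_pos[OF lp]) (auto simp: g_def w_def)
  have "a i \<le> 2 * (\<Sum>j\<in>{i<..?n}. a j)" if i: "i \<le> ?k" for i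
  proof -
    let ?A = "(+) (length w) ` covers (\<lambda>x. p (w @ x)) (\<lambda>x. r (w @ x)) e"
    let ?j = "length y + i"
    have j: "take ?j (w @ e) = y @ take i g"
      using i by (simp add: w_def g_def)
    have "\<not> dist (p (take ?j (w @ e))) (p (w @ e)) < r (take ?j (w @ e))"
    proof
      assume "dist (p (take ?j (w @ e))) (p (w @ e)) < r (take ?j (w @ e))"
      then have "insert ?j ?A \<subseteq> covers p r (w @ e)"
        using i by (auto simp: w_def y_def)
      then have "card (insert ?j ?A) \<le> card (covers p r (w @ e))"
        by (intro card_mono) auto
      \<comment> \<open>The shifted inner covers have lengths beyond \<open>length w\<close>, so
        \<open>?j\<close> is new even for \<open>i = length f\<close>.\<close>
      moreover have "?j \<notin> ?A"
        using i by (auto simp: w_def)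
      moreover have "card ?A = card (covers (\<lambda>x. p (w @ x)) (\<lambda>x. r (w @ x)) e)"
        by (intro card_image) auto
      ultimately have "Suc m \<le> card (covers p r (w @ e))"
        using e(2) by simp
      with no[OF lenE] show False
        by simp
    qed
    then have "a i \<le> dist (p (y @ take i g)) (p (w @ e))"
      by (simp only: j a_def not_less)
    also have "w @ e = (y @ take i g) @ drop i g"
      by (simp add: w_def g_def del: take_append drop_append)
    also have "dist (p (y @ take i g)) (p \<dots>)
        \<le> 2 * (\<Sum>j\<in>{0<..length (drop i g)}. r ((y @ take i g) @ take j (drop i g)))"
      using lenE i by (intro low_ply_path(2)[OF lp]) (simp add: g_def w_def)
    also have "(\<Sum>j\<in>{0<..length (drop i g)}. r ((y @ take i g) @ take j (drop i g)))
        = (\<Sum>j\<in>{i<..?n}. a j)"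
      by (rule sum.reindex_bij_witness[of _ "\<lambda>j. j - i" "\<lambda>j. i + j"]) (auto simp: a_def take_add)
    finally show ?thesis .
  qed
  then have "(\<Sum>j\<in>{0<..?n}. a j) \<le> 3 ^ ?k * (\<Sum>j\<in>{?k<..?n}. a j)" "a 0 \<le> 2 * (\<Sum>j\<in>{0<..?n}. a j)"
    using tail_sum_bound[of ?k a ?n] by (auto simp: g_def)
  then have lower: "a 0 \<le> 2 * 3 ^ ?k * (\<Sum>j\<in>{?k<..?n}. a j)"
    by simp
  have ne: "{?k<..?n} \<noteq> {}"
    using lower pos[of 0] by force
  then have "0 < H"
    using e(1) by (cases H) (auto simp: g_def)
  \<comment> \<open>By \<open>fast\<close>, the at most \<open>H\<close> terms of the tail are each
    too small for \<open>lower\<close>.\<close>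
  have "real H * (2 * 3 ^ ?k * (\<Sum>j\<in>{?k<..?n}. a j)) = (\<Sum>j\<in>{?k<..?n}. 2 * 3 ^ ?k * real H * a j)"
    by (simp add: sum_distrib_left mult_ac)
  also have "\<dots> < (\<Sum>j\<in>{?k<..?n}. a 0)"
  proof (rule sum_strict_mono)
    fix j assume "j \<in> {?k<..?n}"
    then have "take j g = f @ take (j - ?k) e"
      by (simp add: g_def)
    with fast[of "take (j - ?k) e"] e(1) show "2 * 3 ^ ?k * real H * a j < a 0"
      by (simp add: a_def y_def)
  qed (use ne in auto)
  also have "\<dots> \<le> real H * a 0"
    using e(1) pos[of 0] by (simp add: g_def)
  finally have "2 * 3 ^ ?k * (\<Sum>j\<in>{?k<..?n}. a j) < a 0"
    using \<open>0 < H\<close> by simp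
  with lower show False
    by simp
qed

lemma low_ply_covered_path:
  assumes ten: "10 \<le> CARD('a::finite)"
  shows "\<exists>H. \<forall>(p::'a list \<Rightarrow> real^2) r. low_ply M H p r \<longrightarrow> (\<exists>e. length e \<le> H \<and> m \<le> card (covers p r e))"
proof (induction m)
  case (Suc m)
  then obtain H where H: "\<And>(p::'a list \<Rightarrow> real^2) r. low_ply M H p r \<Longrightarrow>
      \<exists>e. length e \<le> H \<and> m \<le> card (covers p r e)"
    by blast
  obtain h where h: "\<And>(p::'a list \<Rightarrow> real^2) r. low_ply M h p r \<Longrightarrow> \<not> slow_decay H h r"
    using slow_decay_height_bound[OF ten] by blast
  have "\<exists>e. length e \<le> Suc h \<and> Suc m \<le> card (covers p r e)" if lp: "low_ply M (Suc h) p r"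
    for p :: "'a list \<Rightarrow> real^2" and r
  proof (rule ccontr)
    assume "\<not> ?thesis"
    then have "card (covers p r e) \<le> m" if "length e \<le> Suc h" for e
      using that by (meson not_less_eq_eq)
    \<comment> \<open>\<open>undefined\<close> stands for an arbitrary child of the root.\<close>
    then have "slow_decay H h (\<lambda>x. r (undefined # x))"
      using covered_path_or_slow_decay[OF H lp] by blast
    moreover have "low_ply M h (\<lambda>x. p ([undefined] @ x)) (\<lambda>x. r ([undefined] @ x))"
      by (rule low_ply_shift[OF lp]) simp
    ultimately show False
      using h by force
  qed
  then show ?case
    by blast
qed auto

lemma low_ply_height_bound:
  assumes ten: "10 \<le> CARD('a::finite)"
  shows "\<exists>h. \<forall>(p::'a list \<Rightarrow> real^2) r. \<not> low_ply M h p r"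
proof -
  obtain H where H: "\<And>(p::'a list \<Rightarrow> real^2) r. low_ply M H p r \<Longrightarrow>
      \<exists>e. length e \<le> H \<and> Suc M \<le> card (covers p r e)"
    using low_ply_covered_path[OF ten] by blast
  have False if lp: "low_ply M H p r" for p :: "'a list \<Rightarrow> real^2" and r
  proof -
    obtain e where e: "length e \<le> H" "Suc M \<le> card (covers p r e)"
      using H[OF lp] by blast
    have "card ((\<lambda>j. take j e) ` covers p r e) = card (covers p r e)"
      by (intro card_image) (auto simp: inj_on_def dest: arg_cong[where f = length])
    moreover have "card ((\<lambda>j. take j e) ` covers p r e) \<le> M"
      using e(1) by (intro low_ply_card[OF lp, of _ "p e"]) auto
    ultimately show False
      using e(2) by simp
  qed
  then show ?thesis
    by blast
qed

section \<open>From drawings of the tree to words\<close>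

lemma ply_radius_ge:
  assumes G: "finite_simple_graph G" and e: "{v, w} \<in> edges G"
  shows "dist (\<Gamma> v) (\<Gamma> w) \<le> 2 * ply_radius G \<Gamma> v" "dist (\<Gamma> v) (\<Gamma> w) \<le> 2 * ply_radius G \<Gamma> w"
proof -
  have ge: "dist (\<Gamma> a) (\<Gamma> b) \<le> 2 * ply_radius G \<Gamma> a" if "{a, b} \<in> edges G" for a b
  proof -
    have "{dist (\<Gamma> a) (\<Gamma> w) | w. {a, w} \<in> edges G} \<subseteq> (\<lambda>w. dist (\<Gamma> a) (\<Gamma> w)) ` verts G"
      using G by (force simp: finite_simple_graph_def)
    then have "finite {dist (\<Gamma> a) (\<Gamma> w) | w. {a, w} \<in> edges G}"
      using G by (meson finite_imageI finite_simple_graph_def finite_subset)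
    then have "dist (\<Gamma> a) (\<Gamma> b) \<le> Max (insert 0 {dist (\<Gamma> a) (\<Gamma> w) | w. {a, w} \<in> edges G})"
      using that by (intro Max_ge) auto
    then show ?thesis
      by (simp add: ply_radius_def)
  qed
  show "dist (\<Gamma> v) (\<Gamma> w) \<le> 2 * ply_radius G \<Gamma> v"
    using ge e by simp
  show "dist (\<Gamma> v) (\<Gamma> w) \<le> 2 * ply_radius G \<Gamma> w"
    using ge[of w v] e by (simp add: insert_commute dist_commute)
qed

lemma complete_tree_drawing_low_ply:
  fixes c :: "'a::finite \<Rightarrow> nat"
  assumes \<Gamma>: "straight_line_drawing (complete_tree d h) \<Gamma>" and h: "0 < h"
    and c: "inj c" "range c = {..<d}"
  shows "low_ply (drawing_ply_number (complete_tree d h) \<Gamma>) h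
    (\<lambda>x. \<Gamma> (map c x)) (\<lambda>x. ply_radius (complete_tree d h) \<Gamma> (map c x))"
proof -
  define G where "G = complete_tree d h"
  have G: "finite_simple_graph G"
    by (simp add: G_def finite_simple_graph_complete_tree)
  have vert: "map c x \<in> verts G" if "length x \<le> h" for x
    using that c(2) by (auto simp: G_def complete_tree_def)
  have edge: "{map c x, map c (x @ [i])} \<in> edges G" if "length x < h" for x i
  proof -
    have "{map c x, map c x @ [c i]} \<in> edges G"
      using that c(2) unfolding G_def complete_tree_def by fastforce
    then show ?thesis
      by simp
  qed
  have inj: "x = x'" if "length x \<le> h" "length x' \<le> h" "\<Gamma> (map c x) = \<Gamma> (map c x')" for x x'
  proof -
    have "map c x = map c x'"
      using \<Gamma> vert that by (auto simp: straight_line_drawing_def inj_on_def simp flip: G_def)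
    then show ?thesis
      using c(1) by (simp add: inj_map_eq_map)
  qed
  note rad = ply_radius_ge[OF G edge, of _ \<Gamma>]
  have pos: "0 < ply_radius G \<Gamma> (map c x)" if x: "length x \<le> h" for x
  proof (cases "length x < h")
    case True
    then have "0 < dist (\<Gamma> (map c x)) (\<Gamma> (map c (x @ [undefined])))"
      using inj[of x "x @ [undefined]"] by auto
    with rad(1)[OF True] show ?thesis
      by (smt (verit))
  next
    case False
    \<comment> \<open>A vertex at depth \<open>h\<close> has only the edge to its parent, which
      exists because \<open>0 < h\<close>.\<close>
    with x h obtain y i where y: "x = y @ [i]" "length y < h"
      by (cases x rule: rev_cases) auto
    then have "0 < dist (\<Gamma> (map c y)) (\<Gamma> (map c x))"
      using inj[of y x] by auto
    with rad(2)[OF y(2), of i] y(1) show ?thesis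
      by (smt (verit))
  qed
  have "card {x. length x \<le> h \<and> dist (\<Gamma> (map c x)) q < ply_radius G \<Gamma> (map c x)}
      \<le> drawing_ply_number G \<Gamma>" for q
  proof -
    let ?S = "{x. length x \<le> h \<and> dist (\<Gamma> (map c x)) q < ply_radius G \<Gamma> (map c x)}"
    \<comment> \<open>The ply counts disks as sets, whereas \<open>low_ply\<close> counts words. A
      nonempty ball determines its centre and hence the word.\<close>
    have "inj_on (\<lambda>x. ply_disk G \<Gamma> (map c x)) ?S"
    proof (rule inj_onI)
      fix x x'
      assume "x \<in> ?S" "x' \<in> ?S" "ply_disk G \<Gamma> (map c x) = ply_disk G \<Gamma> (map c x')"
      then show "x = x'"
        using pos[of x] pos[of x'] by (intro inj) (auto simp: ply_disk_def ball_eq_ball_iff)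
    qed
    moreover have "(\<lambda>x. ply_disk G \<Gamma> (map c x)) ` ?S \<subseteq> ply_disks_at G \<Gamma> q"
      using vert by (auto simp: ply_disks_at_def dist_norm)
    ultimately have "card ?S \<le> card (ply_disks_at G \<Gamma> q)"
      using ply_disks_at_bound(1)[OF G] by (intro card_inj_on_le)
    also have "\<dots> \<le> drawing_ply_number G \<Gamma>"
      unfolding drawing_ply_number_def
      using finite_ply_counts(1)[OF G, of \<Gamma>] by (intro Max_ge) auto
    finally show ?thesis .
  qed
  with pos rad show ?thesis
    unfolding low_ply_def G_def[symmetric] by simp
qed

theorem theorem2:
  fixes M :: real
  assumes "M > 0"
  shows "\<exists>h::nat. h > 0 \<and> real (ply_number (complete_tree 10 h)) \<ge> M"
proof -
  define N where "N = nat \<lceil>M\<rceil>"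
  obtain h where no: "\<And>(p :: 10 list \<Rightarrow> real^2) r. \<not> low_ply N h p r"
    using low_ply_height_bound[where 'a = 10 and M = N] by auto
  obtain c :: "10 \<Rightarrow> nat" where c: "inj c" "range c = {..<10}"
    using ex_bij_betw_finite_nat[of "UNIV :: 10 set"]
    by (auto simp: bij_betw_def atLeast0LessThan)
  \<comment> \<open>\<open>Suc h\<close> ensures a positive height; the extra level is cut off below
    by a shift along \<open>[]\<close>.\<close>
  let ?G = "complete_tree 10 (Suc h)"
  have "M \<le> real (ply_number ?G)"
  proof (rule ccontr)
    assume "\<not> M \<le> real (ply_number ?G)"
    then have "ply_number ?G \<le> N"
      unfolding N_def by linarith
    moreover have "ply_number ?G \<in> {drawing_ply_number ?G \<Gamma> | \<Gamma>. straight_line_drawing ?G \<Gamma>}"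
      unfolding ply_number_def
      by (intro Min_in finite_drawing_ply_numbers finite_simple_graph_complete_tree)
    ultimately obtain \<Gamma> where \<Gamma>: "straight_line_drawing ?G \<Gamma>" "drawing_ply_number ?G \<Gamma> \<le> N"
      by auto
    have "low_ply N (Suc h) (\<lambda>x. \<Gamma> (map c x)) (\<lambda>x. ply_radius ?G \<Gamma> (map c x))"
      using complete_tree_drawing_low_ply[OF \<Gamma>(1) _ c] \<Gamma>(2)
      unfolding low_ply_def by (auto intro: le_trans)
    then have "low_ply N h (\<lambda>x. \<Gamma> (map c ([] @ x))) (\<lambda>x. ply_radius ?G \<Gamma> (map c ([] @ x)))"
      by (rule low_ply_shift) simp
    with no show False
      by blast
  qed
  then show ?thesis
    by blast
qed

end
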